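(* Let $n\geq 2$ be an integer and let $S$ be a sequence in $\mathbb Z_n$. Then $S$ is a $C$-extremal sequence for $(\mathbb Z_n',\{1\})$ if and only if $S$ is a translate of a sequence which is order-equivalent to the sequence $(0,1,0)$.
   Context: $\mathbb Z_n=\mathbb Z/n\mathbb Z$ as a module over itself and $\mathbb Z_n'=\mathbb Z_n\setminus\{0\}$. For non-empty $A,B\subseteq\mathbb Z_n$, a sequence $(x_1,\ldots,x_k)$ is an $(A,B)$-weighted zero-sum sequence if there exist $a_i\in A$, $b_i\in B$ with $\sum a_ix_i=0$ and $\sum b_ia_i=0$. $C_{A,B}(n)$ is the least positive $k$ such that every sequence of length $k$ in $\mathbb Z_n$ has an $(A,B)$-weighted zero-sum subsequence having consecutive terms (a non-empty block $(x_i,\ldots,x_j)$); a $C$-extremal sequence for $(A,B)$ is a sequence of length $C_{A,B}(n)-1$ having no such subsequence. A translate of $(x_1,\ldots,x_k)$ is $(x_1+x,\ldots,x_k+x)$ for some $x\in\mathbb Z_n$. Sequences $(x_1,\ldots,x_k)$ and $(y_1,\ldots,y_k)$ are order-equivalent if there is a unit $u\in\mathbb Z_n$ with $y_i=ux_i$ for all $i$. *)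

theory Defs
  imports "HOL-Number_Theory.Residues" "HOL-Library.Sublist"
begin

text \<open>
  The ring of integers modulo \<open>n\<close> is \<^term>\<open>residue_ring n\<close>, with carrier \<open>{0..n - 1}\<close>;
  it is the intended ring for \<open>n \<ge> 2\<close>. A sequence in it is a list \<open>S\<close> with
  \<open>set S \<subseteq> carrier (residue_ring n)\<close>, and weight sets are subsets of the carrier.
\<close>

definition nonzero_residues :: "int \<Rightarrow> int set" where
  "nonzero_residues n = carrier (residue_ring n) - {\<zero>\<^bsub>residue_ring n\<^esub>}"

definition weighted_zero_sum :: "int \<Rightarrow> int set \<Rightarrow> int set \<Rightarrow> int list \<Rightarrow> bool" where
  "weighted_zero_sum n A B xs \<longleftrightarrow>
    (\<exists>a b. (\<forall>i<length xs. a i \<in> A \<and> b i \<in> B) \<and>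
      (\<Oplus>\<^bsub>residue_ring n\<^esub>i\<in>{..<length xs}. a i \<otimes>\<^bsub>residue_ring n\<^esub> xs ! i)
        = \<zero>\<^bsub>residue_ring n\<^esub> \<and>
      (\<Oplus>\<^bsub>residue_ring n\<^esub>i\<in>{..<length xs}. b i \<otimes>\<^bsub>residue_ring n\<^esub> a i)
        = \<zero>\<^bsub>residue_ring n\<^esub>)"

text \<open>\<^const>\<open>sublist\<close> is the relation of being a contiguous block.\<close>

definition has_zero_sum_block :: "int \<Rightarrow> int set \<Rightarrow> int set \<Rightarrow> int list \<Rightarrow> bool" where
  "has_zero_sum_block n A B xs \<longleftrightarrow>
    (\<exists>ys. ys \<noteq> [] \<and> sublist ys xs \<and> weighted_zero_sum n A B ys)"

text \<open>
  For \<open>n \<ge> 1\<close> and non-empty \<open>A\<close> and \<open>B\<close>, the set whose least element is taken is non-empty: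
  with constant weights, two of the prefix sums over lengths divisible by \<open>n\<close>
  coincide in any sufficiently long sequence.
\<close>

definition C_const :: "int \<Rightarrow> int set \<Rightarrow> int set \<Rightarrow> nat" where
  "C_const n A B = (LEAST k. k > 0 \<and>
    (\<forall>xs. set xs \<subseteq> carrier (residue_ring n) \<and> length xs = k \<longrightarrow> has_zero_sum_block n A B xs))"

definition C_extremal :: "int \<Rightarrow> int set \<Rightarrow> int set \<Rightarrow> int list \<Rightarrow> bool" where
  "C_extremal n A B xs \<longleftrightarrow>
    set xs \<subseteq> carrier (residue_ring n) \<and> length xs = C_const n A B - 1 \<and>
    \<not> has_zero_sum_block n A B xs"

definition is_translate :: "int \<Rightarrow> int list \<Rightarrow> int list \<Rightarrow> bool" where
  "is_translate n ys xs \<longleftrightarrow>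
    (\<exists>x\<in>carrier (residue_ring n). ys = map (\<lambda>t. t \<oplus>\<^bsub>residue_ring n\<^esub> x) xs)"

definition order_equivalent :: "int \<Rightarrow> int list \<Rightarrow> int list \<Rightarrow> bool" where
  "order_equivalent n xs ys \<longleftrightarrow>
    (\<exists>u\<in>Units (residue_ring n). ys = map (\<lambda>t. u \<otimes>\<^bsub>residue_ring n\<^esub> t) xs)"

end

theory Submission
  imports Defs
begin

text \<open>
  A pair \<open>(x, y)\<close> is free of weighted zero sums iff \<open>y - x\<close> is a unit. A triple \<open>(x, y, z)\<close>
  always satisfies \<open>(z - y) x + (x - z) y + (y - x) z = 0\<close> with weights adding up to \<open>0\<close>, so
  if its consecutive differences are units, it can only be free of weighted zero sums when
  \<open>z = x\<close>. Hence the block-free triples are the \<open>(x, x + u, x)\<close> with \<open>u\<close> a unit, and a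
  block-free sequence of length four would have to be \<open>(x, x + u, x, x + u)\<close>, which is
  a zero sum for the weights \<open>1, -1, -1, 1\<close>. So the constant is \<open>4\<close>.
\<close>

section \<open>Weighted zero sums as divisibility statements over the integers\<close>

context residues
begin

lemma finsum_eq_sum_mod:
  assumes "finite I"
  shows "(\<Oplus>i\<in>I. f i mod m) = (\<Sum>i\<in>I. f i) mod m"
  using assms
proof (induction rule: finite_induct)
  case empty
  then show ?case by (simp add: res_zero_eq)
next
  case (insert j I)
  have "(\<lambda>i. f i mod m) \<in> I \<rightarrow> carrier R"
    by (auto simp: mod_in_carrier)
  then have "(\<Oplus>i\<in>insert j I. f i mod m) = (f j mod m) \<oplus> (\<Oplus>i\<in>I. f i mod m)"
    using insert.hyps by (intro finsum_insert) (auto simp: mod_in_carrier)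
  then show ?case
    using insert by (simp add: res_add_eq mod_simps)
qed

lemma nonzero_residues_eq: "nonzero_residues m = {1..m - 1}"
  by (auto simp: nonzero_residues_def R_m_def[symmetric] res_carrier_eq res_zero_eq)

text \<open>Reducing integer weights modulo \<open>m\<close> changes neither sum modulo
  \<open>m\<close>, and weights not divisible by \<open>m\<close> land in \<open>{1..m - 1}\<close>.
  Working with arbitrary integer weights permits negative ones and differences of entries.\<close>

lemma weighted_zero_sum_iff:
  "weighted_zero_sum m (nonzero_residues m) {1} xs \<longleftrightarrow>
    (\<exists>a. (\<forall>i<length xs. \<not> m dvd a i) \<and> m dvd (\<Sum>i<length xs. a i * xs ! i) \<and>
      m dvd (\<Sum>i<length xs. a i))"
  (is "?L \<longleftrightarrow> (\<exists>a. ?P a)")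
proof
  assume ?L
  then obtain a b where ab: "\<forall>i<length xs. a i \<in> {1..m - 1} \<and> b i = 1"
    and sums: "(\<Oplus>i\<in>{..<length xs}. a i \<otimes> xs ! i) = \<zero>"
      "(\<Oplus>i\<in>{..<length xs}. b i \<otimes> a i) = \<zero>"
    unfolding weighted_zero_sum_def nonzero_residues_eq R_m_def[symmetric] by auto
  have "(\<Sum>i<length xs. b i * a i) = (\<Sum>i<length xs. a i)"
    using ab by (intro sum.cong) auto
  moreover have "\<not> m dvd a i" if "i < length xs" for i
    using ab that zdvd_not_zless[of "a i" m] by force
  ultimately have "?P a"
    using sums by (simp add: res_mult_eq res_zero_eq finsum_eq_sum_mod mod_eq_0_iff_dvd)
  then show "\<exists>a. ?P a" by blast
next
  assume "\<exists>a. ?P a"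
  then obtain a where a: "?P a" ..
  define c where "c i = a i mod m" for i
  have "c i \<in> {1..m - 1}" if "i < length xs" for i
  proof -
    have "c i \<noteq> 0" "0 \<le> c i" "c i < m"
      using a that m_gt_one by (auto simp: c_def dvd_eq_mod_eq_0)
    then show ?thesis by simp
  qed
  moreover have "(\<Oplus>i\<in>{..<length xs}. c i \<otimes> xs ! i) = \<zero>"
    using a finsum_eq_sum_mod[of "{..<length xs}" "\<lambda>i. a i * xs ! i"]
    by (simp add: c_def res_mult_eq res_zero_eq mod_eq_0_iff_dvd mod_simps)
  moreover have "(\<Oplus>i\<in>{..<length xs}. 1 \<otimes> c i) = \<zero>"
    using a finsum_eq_sum_mod[of "{..<length xs}" a]
    by (simp add: c_def res_mult_eq res_zero_eq mod_eq_0_iff_dvd mod_simps)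
  ultimately show ?L
    unfolding weighted_zero_sum_def nonzero_residues_eq R_m_def[symmetric]
    by (intro exI[of _ c] exI[of _ "\<lambda>_. 1"]) auto
qed

lemma weighted_zero_sumI:
  assumes "length as = length xs" "\<forall>i<length xs. \<not> m dvd as ! i"
    and "m dvd (\<Sum>i<length xs. as ! i * xs ! i)" "m dvd (\<Sum>i<length xs. as ! i)"
  shows "weighted_zero_sum m (nonzero_residues m) {1} xs"
  using assms unfolding weighted_zero_sum_iff by blast

section \<open>Blocks of length at most three\<close>

lemma not_weighted_zero_sum_singleton:
  "\<not> weighted_zero_sum m (nonzero_residues m) {1} [x]"
  by (auto simp: weighted_zero_sum_iff)

lemma not_dvd_mult_of_coprime:
  assumes "coprime d m" "m dvd b * d" shows "m dvd b"
  using assms by (simp add: coprime_dvd_mult_left_iff coprime_commute)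

text \<open>Two weights adding up to zero are \<open>- b\<close> and \<open>b\<close> modulo
  \<open>m\<close>, so a zero sum means that some \<open>b\<close> not divisible by \<open>m\<close>
  annihilates \<open>y - x\<close>.\<close>

lemma weighted_zero_sum_pair_iff:
  "weighted_zero_sum m (nonzero_residues m) {1} [x, y] \<longleftrightarrow> \<not> coprime (y - x) m"
proof
  assume "weighted_zero_sum m (nonzero_residues m) {1} [x, y]"
  then obtain a :: "nat \<Rightarrow> int" where a: "\<not> m dvd a 1" "m dvd a 0 * x + a 1 * y" "m dvd a 0 + a 1"
    unfolding weighted_zero_sum_iff by (auto simp: numeral_2_eq_2)
  have "m dvd (a 0 * x + a 1 * y) - (a 0 + a 1) * x"
    using a by (intro dvd_diff dvd_mult2)
  then have "m dvd a 1 * (y - x)" by (simp add: algebra_simps)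
  then show "\<not> coprime (y - x) m"
    using a(1) not_dvd_mult_of_coprime by blast
next
  assume nc: "\<not> coprime (y - x) m"
  define g where "g = gcd (y - x) m"
  have "g > 0" using m_gt_one by (simp add: g_def)
  have "g \<noteq> 1" using nc by (simp add: g_def coprime_iff_gcd_eq_1)
  \<comment> \<open>The cofactor \<open>k\<close> of the gcd is the annihilator:
    \<open>g > 1\<close> makes it smaller than \<open>m\<close>, while \<open>g dvd y - x\<close>
    gives \<open>m dvd k * (y - x)\<close>.\<close>
  obtain k where k: "m = g * k" unfolding g_def by (metis dvdE gcd_dvd2)
  have "k > 0" using k m_gt_one \<open>g > 0\<close> zero_less_mult_pos[of g k] by linarith
  moreover have "k < m" using k \<open>g > 0\<close> \<open>g \<noteq> 1\<close> \<open>k > 0\<close> by simp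
  ultimately have "\<not> m dvd k" by (simp add: zdvd_not_zless)
  moreover have "m dvd k * (y - x)"
    by (subst k) (simp add: g_def mult.commute mult_dvd_mono)
  ultimately show "weighted_zero_sum m (nonzero_residues m) {1} [x, y]"
    by (intro weighted_zero_sumI[of "[- k, k]"])
      (auto simp: numeral_2_eq_2 less_Suc_eq algebra_simps)
qed

lemma weighted_zero_sum_triple_iff:
  assumes "coprime (y - x) m" "coprime (z - y) m"
  shows "weighted_zero_sum m (nonzero_residues m) {1} [x, y, z] \<longleftrightarrow> \<not> m dvd z - x"
proof
  assume "weighted_zero_sum m (nonzero_residues m) {1} [x, y, z]"
  then obtain a :: "nat \<Rightarrow> int" where a: "\<not> m dvd a 1"
    "m dvd a 0 * x + a 1 * y + a 2 * z" "m dvd a 0 + a 1 + a 2"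
    unfolding weighted_zero_sum_iff by (auto simp: numeral_2_eq_2 numeral_3_eq_3)
  show "\<not> m dvd z - x"
  proof
    assume "m dvd z - x"
    \<comment> \<open>With \<open>z\<close> congruent to \<open>x\<close>, the two outer weights act
      as one; eliminating them leaves \<open>a 1 * (y - x)\<close>, as for a pair.\<close>
    then have "m dvd (a 0 * x + a 1 * y + a 2 * z) - (a 0 + a 1 + a 2) * x - (z - x) * a 2"
      using a by (intro dvd_diff[OF dvd_diff] dvd_mult2)
    then have "m dvd a 1 * (y - x)" by (simp add: algebra_simps)
    then show False using a(1) assms(1) not_dvd_mult_of_coprime by blast
  qed
next
  assume "\<not> m dvd z - x"
  then have "\<not> m dvd x - z" by (simp add: dvd_diff_commute)
  \<comment> \<open>The weights below are differences of entries, so each of the three must be shown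
    nonzero modulo \<open>m\<close>; units are, because \<open>m > 1\<close>.\<close>
  moreover have "\<not> m dvd d" if "coprime d m" for d
    using that m_gt_one not_dvd_mult_of_coprime[of d 1] by auto
  then have "\<not> m dvd y - x" "\<not> m dvd z - y"
    using assms by blast+
  ultimately show "weighted_zero_sum m (nonzero_residues m) {1} [x, y, z]"
    by (intro weighted_zero_sumI[of "[z - y, x - z, y - x]"])
      (auto simp: numeral_3_eq_3 less_Suc_eq algebra_simps)
qed

lemma has_zero_sum_block_triple_iff:
  "has_zero_sum_block m (nonzero_residues m) {1} [x, y, z] \<longleftrightarrow>
    \<not> (coprime (y - x) m \<and> m dvd z - x)"
proof -
  \<comment> \<open>Modulo \<open>m\<close>, \<open>z - y\<close> is the negative of
    \<open>y - x\<close>, so the second pair imposes no further condition.\<close>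
  have "coprime (z - y) m" if "coprime (y - x) m" "m dvd z - x"
  proof (rule coprimeI)
    fix c assume c: "c dvd z - y" "c dvd m"
    then have "c dvd (z - x) - (z - y)" using that by (meson dvd_diff dvd_trans)
    then show "is_unit c" using c that(1) coprime_common_divisor by fastforce
  qed
  moreover have "has_zero_sum_block m A B [x, y, z] \<longleftrightarrow>
      (\<exists>ys \<in> {[x], [y], [z], [x, y], [y, z], [x, y, z]}. weighted_zero_sum m A B ys)" for A B
    unfolding has_zero_sum_block_def in_set_sublists[symmetric] by auto
  ultimately show ?thesis
    using weighted_zero_sum_triple_iff[of y x z]
    by (auto simp: not_weighted_zero_sum_singleton weighted_zero_sum_pair_iff)
qed

end

section \<open>The value of the constant\<close>

lemma has_zero_sum_block_mono:
  assumes "has_zero_sum_block n A B xs" "sublist xs ys"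
  shows "has_zero_sum_block n A B ys"
  using assms unfolding has_zero_sum_block_def by (meson sublist_order.order.trans)

context residues
begin

lemma has_zero_sum_block_length_4:
  assumes "length xs = 4"
  shows "has_zero_sum_block m (nonzero_residues m) {1} xs"
proof (rule ccontr)
  assume no: "\<not> ?thesis"
  obtain x y z w where xs: "xs = [x, y, z, w]"
    using assms by (auto simp: eval_nat_numeral length_Suc_conv)
  have "sublist [x, y, z] xs" "sublist [y, z, w] xs"
    by (auto simp: xs sublist_Cons_right)
  then have "m dvd z - x" "m dvd w - y"
    using no has_zero_sum_block_mono has_zero_sum_block_triple_iff by blast+
  \<comment> \<open>This difference is the weighted sum \<open>x - y - z + w\<close>.\<close>
  then have "m dvd (w - y) - (z - x)" by (rule dvd_diff[rotated])
  then have "weighted_zero_sum m (nonzero_residues m) {1} xs"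
    unfolding xs using m_gt_one
    by (intro weighted_zero_sumI[of "[1, -1, -1, 1]"])
      (auto simp: eval_nat_numeral less_Suc_eq algebra_simps)
  then show False
    using no xs unfolding has_zero_sum_block_def by blast
qed

lemma C_const_eq_4: "C_const m (nonzero_residues m) {1} = 4"
  unfolding C_const_def
proof (rule Least_equality)
  show "4 > (0::nat) \<and> (\<forall>xs. set xs \<subseteq> carrier (residue_ring m) \<and> length xs = 4 \<longrightarrow>
    has_zero_sum_block m (nonzero_residues m) {1} xs)"
    by (simp add: has_zero_sum_block_length_4)
next
  fix k :: nat
  assume k: "k > 0 \<and> (\<forall>xs. set xs \<subseteq> carrier (residue_ring m) \<and> length xs = k \<longrightarrow>
    has_zero_sum_block m (nonzero_residues m) {1} xs)"
  show "4 \<le> k"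
  proof (rule ccontr)
    assume "\<not> 4 \<le> k"
    \<comment> \<open>Prefixes of the block-free sequence \<open>[0, 1, 0]\<close> rule out all
      \<open>k < 4\<close> at once, since a block of a prefix is a block of the whole.\<close>
    then have "length (take k [0, 1, 0 :: int]) = k" by simp
    moreover have "set (take k [0, 1, 0]) \<subseteq> carrier (residue_ring m)"
      using set_take_subset[of k "[0, 1, 0 :: int]"] m_gt_one
      by (auto simp: R_m_def[symmetric] res_carrier_eq)
    ultimately have "has_zero_sum_block m (nonzero_residues m) {1} (take k [0, 1, 0])"
      using k by blast
    then have "has_zero_sum_block m (nonzero_residues m) {1} [0, 1, 0]"
      by (rule has_zero_sum_block_mono) simp
    then show False by (simp add: has_zero_sum_block_triple_iff)
  qed
qed

section \<open>Extremal sequences, order-equivalence and translates\<close>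

lemma C_extremal_iff:
  assumes "set S \<subseteq> carrier R"
  shows "C_extremal m (nonzero_residues m) {1} S \<longleftrightarrow>
    (\<exists>x y. S = [x, y, x] \<and> coprime (y - x) m)"
proof
  assume ext: "C_extremal m (nonzero_residues m) {1} S"
  then have "length S = 3" by (simp add: C_extremal_def C_const_eq_4)
  then obtain x y z where S: "S = [x, y, z]"
    by (auto simp: eval_nat_numeral length_Suc_conv)
  have "coprime (y - x) m" "m dvd z - x"
    using ext by (auto simp: S C_extremal_def has_zero_sum_block_triple_iff)
  \<comment> \<open>Both are representatives in \<open>{0..m - 1}\<close>, so congruence is
    equality.\<close>
  moreover from this have "z = x"
    using assms by (auto simp: S res_carrier_eq mod_eq_dvd_iff[symmetric])
  ultimately show "\<exists>x y. S = [x, y, x] \<and> coprime (y - x) m" using S by blast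
next
  assume "\<exists>x y. S = [x, y, x] \<and> coprime (y - x) m"
  then show "C_extremal m (nonzero_residues m) {1} S"
    using assms
    by (auto simp: C_extremal_def C_const_eq_4 has_zero_sum_block_triple_iff R_m_def[symmetric])
qed

lemma order_equivalent_010_iff:
  assumes "set T \<subseteq> carrier R"
  shows "order_equivalent m T [\<zero>, \<one>, \<zero>] \<longleftrightarrow> (\<exists>v\<in>Units R. T = [\<zero>, v, \<zero>])"
proof
  assume "order_equivalent m T [\<zero>, \<one>, \<zero>]"
  then obtain u where u: "u \<in> Units R" "map (\<lambda>t. u \<otimes> t) T = [\<zero>, \<one>, \<zero>]"
    unfolding order_equivalent_def R_m_def[symmetric] by metis
  from u(2) have "length T = 3" by (auto dest: arg_cong[of _ _ length])
  then obtain a v b where T: "T = [a, v, b]"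
    by (auto simp: eval_nat_numeral length_Suc_conv)
  \<comment> \<open>The unit multiplies \<open>T\<close>, not \<open>(0, 1, 0)\<close>, so the
    middle entry of \<open>T\<close> is the inverse of \<open>u\<close>.\<close>
  have eqs: "u \<otimes> a = \<zero>" "u \<otimes> v = \<one>" "u \<otimes> b = \<zero>"
    using u(2) unfolding T by simp_all
  have uc: "u \<in> carrier R" using u(1) by blast
  have zero: "t = \<zero>" if "u \<otimes> t = \<zero>" "t \<in> carrier R" for t
    using Units_l_cancel[OF u(1) that(2) zero_closed] that(1) uc by simp
  have "v \<in> Units R"
    using eqs(2) uc assms T m_comm[of u v] by (auto simp: Units_def)
  then show "\<exists>v\<in>Units R. T = [\<zero>, v, \<zero>]"
    using zero eqs assms T by auto
next
  assume "\<exists>v\<in>Units R. T = [\<zero>, v, \<zero>]"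
  then show "order_equivalent m T [\<zero>, \<one>, \<zero>]"
    unfolding order_equivalent_def R_m_def[symmetric]
    by (auto intro!: bexI[of _ "inv _"])
qed

end

theorem theorem10:
  fixes n :: int and S :: "int list"
  assumes "n \<ge> 2"
    and "set S \<subseteq> carrier (residue_ring n)"
  shows "C_extremal n (nonzero_residues n) {\<one>\<^bsub>residue_ring n\<^esub>} S \<longleftrightarrow>
    (\<exists>T. set T \<subseteq> carrier (residue_ring n) \<and>
      order_equivalent n T
        [\<zero>\<^bsub>residue_ring n\<^esub>, \<one>\<^bsub>residue_ring n\<^esub>, \<zero>\<^bsub>residue_ring n\<^esub>] \<and>
      is_translate n S T)"
proof -
  define R where "R = residue_ring n"
  interpret residues n R
    using assms(1) by unfold_locales (simp_all add: R_def)
  have S: "set S \<subseteq> carrier R" using assms(2) by (simp add: R_def)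
  \<comment> \<open>The shift is the outer entry \<open>x\<close>, and the unit \<open>v\<close> is
    the residue of \<open>y - x\<close>.\<close>
  have "(\<exists>x y. S = [x, y, x] \<and> coprime (y - x) n) \<longleftrightarrow>
    (\<exists>v\<in>Units R. is_translate n S [\<zero>\<^bsub>R\<^esub>, v, \<zero>\<^bsub>R\<^esub>])" (is "?L \<longleftrightarrow> ?R")
  proof
    assume ?L
    then obtain x y where xy: "S = [x, y, x]" "coprime (y - x) n" by blast
    then have "x \<in> carrier R" "y \<in> carrier R" using S by auto
    moreover from this have "S = map (\<lambda>t. t \<oplus>\<^bsub>R\<^esub> x) [\<zero>\<^bsub>R\<^esub>, (y - x) mod n, \<zero>\<^bsub>R\<^esub>]"
      by (simp add: xy res_add_eq res_zero_eq res_carrier_eq mod_simps)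
    moreover have "(y - x) mod n \<in> Units R"
    proof -
      have "coprime ((y - x) mod n) n" using xy(2) m_gt_one by simp
      \<comment> \<open>\<open>res_units_eq\<close> asks for strictly positive representatives;
        \<open>0\<close> is not coprime to \<open>n > 1\<close>.\<close>
      moreover from this have "(y - x) mod n \<noteq> 0" using m_gt_one by auto
      ultimately show ?thesis
        using m_gt_one pos_mod_bound[of n "y - x"] pos_mod_sign[of n "y - x"]
        by (simp add: res_units_eq order.not_eq_order_implies_strict)
    qed
    ultimately show ?R
      unfolding is_translate_def R_def[symmetric] by blast
  next
    assume ?R
    then obtain v x where v: "v \<in> Units R" and x: "x \<in> carrier R"
      and eq: "S = map (\<lambda>t. t \<oplus>\<^bsub>R\<^esub> x) [\<zero>\<^bsub>R\<^esub>, v, \<zero>\<^bsub>R\<^esub>]"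
      unfolding is_translate_def R_def[symmetric] by blast
    have "S = [x, (v + x) mod n, x]"
      using eq x by (simp add: res_add_eq res_zero_eq res_carrier_eq)
    moreover have "coprime ((v + x) mod n - x) n"
    proof -
      have "((v + x) mod n - x) mod n = v mod n" by (simp add: mod_simps)
      moreover have "coprime (v mod n) n" using v m_gt_one by (simp add: res_units_eq)
      ultimately show ?thesis
        using m_gt_one by (metis coprime_mod_left_iff not_one_less_zero)
    qed
    ultimately show ?L by blast
  qed
  also have "\<dots> \<longleftrightarrow> (\<exists>T. set T \<subseteq> carrier R \<and>
      order_equivalent n T [\<zero>\<^bsub>R\<^esub>, \<one>\<^bsub>R\<^esub>, \<zero>\<^bsub>R\<^esub>] \<and> is_translate n S T)"
  proof -
    have "set [\<zero>\<^bsub>R\<^esub>, v, \<zero>\<^bsub>R\<^esub>] \<subseteq> carrier R" if "v \<in> Units R" for v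
      using that by auto
    then show ?thesis using order_equivalent_010_iff by blast
  qed
  finally show ?thesis
    using C_extremal_iff[OF S] by (simp add: R_def[symmetric] res_one_eq)
qed

end
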